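(* Let $d\ge 1$, $q\ge 0$, let $\Omega\subseteq\mathbf{R}^d$ be a region and $w\ge 0$ a suitable weight function on $\Omega$. Let $n=\binom{d+q}{d}=\dim\mathcal{P}_q$ and let $\{e_a\}_{a=1}^n$ be an orthonormal basis of $\mathcal{P}_q$. Suppose there is a degree $2q+1$, $N$-point cubature rule $\int_\Omega w(x)f(x)\,d^dx\approx\sum_{\alpha=1}^N w_\alpha f(x_\alpha)$ with nodes $x_\alpha\in\mathbf{R}^d$ and positive weights $w_\alpha$. Let $Q$ be the $n\times N$ matrix with entries $Q_{a\alpha}=\sqrt{w_\alpha}\,e_a(x_\alpha)$, let $\Lambda_i$ ($i=1,\dots,d$) be the $N\times N$ diagonal matrix with diagonal entries $(\Lambda_i)_{\alpha\alpha}=(x_\alpha)_i$, let $\tilde Q$ be any $N\times N$ orthogonal matrix whose first $n$ rows form $Q$, and let $\tilde A_i=\tilde Q\Lambda_i\tilde Q^T$. Let $\iota:\mathcal{P}_q\to\mathbf{R}^N$ be the linear map sending $e_a$ to the $a$-th standard basis vector of $\mathbf{R}^N$, $a=1,\dots,n$. Then for every $i=1,\dots,d$ $$\tilde A_i\,\iota p=\iota(x_ip)=\iota(\chi_ip)\qquad\text{for all }p\in\mathcal{P}_{q-1}.$$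
   Context: All matrices are real. "Suitable" weight: $\Omega\subseteq\mathbf{R}^d$ and $w:\Omega\to[0,\infty)$ are measurable, $\int_\Omega w(x)|p(x)|\,d^dx<\infty$ for every polynomial $p$, and $\int_\Omega w(x)p(x)^2\,d^dx>0$ for every nonzero polynomial $p$. $\mathcal{P}_m$ is the real vector space of polynomials in $x_1,\dots,x_d$ of total degree at most $m$ (with $\mathcal{P}_{-1}=\{0\}$), with inner product $\langle a|b\rangle=\int_\Omega w(x)a(x)b(x)\,d^dx$; $\mathcal{P}_{q-1}$ is regarded as a subspace of $\mathcal{P}_q$. $\Pi_q:\mathcal{P}_{q+1}\to\mathcal{P}_q$ is the orthogonal projection with respect to this inner product, and $\chi_i:\mathcal{P}_q\to\mathcal{P}_q$ is defined by $\chi_ip=\Pi_q(x_ip)$. A cubature rule is of degree $D$ if it is exact (equality holds) for every polynomial $f$ of total degree at most $D$ and non-exact for at least one polynomial of total degree $D+1$. *)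

theory Defs
  imports "HOL-Analysis.Analysis" "Jordan_Normal_Form.Matrix"
begin

no_notation vec_index (infixl "$" 100)

(* Polynomials over the infinite field of reals are identified with the functions they induce.
   The bound is an integer so that bound -1 is available: no exponent satisfies it, and
   the only member of polys (-1) is the zero function. *)

definition monomial_fun :: "('d::finite \<Rightarrow> nat) \<Rightarrow> real ^ 'd \<Rightarrow> real" where
  "monomial_fun k x = (\<Prod>i\<in>UNIV. (x $ i) ^ k i)"

definition polys :: "int \<Rightarrow> (real ^ 'd::finite \<Rightarrow> real) set" where
  "polys m = {p. \<exists>c. p = (\<lambda>x. \<Sum>k | int (\<Sum>i\<in>UNIV. k i) \<le> m. c k * monomial_fun k x)}"

definition suitable_weight :: "(real ^ 'd::finite) set \<Rightarrow> (real ^ 'd \<Rightarrow> real) \<Rightarrow> bool" where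
  "suitable_weight \<Omega> w \<longleftrightarrow>
     \<Omega> \<in> sets lebesgue \<and>
     w \<in> borel_measurable (lebesgue_on \<Omega>) \<and>
     (\<forall>x\<in>\<Omega>. 0 \<le> w x) \<and>
     (\<forall>m. \<forall>p\<in>polys m. integrable (lebesgue_on \<Omega>) (\<lambda>x. w x * \<bar>p x\<bar>)) \<and>
     (\<forall>m. \<forall>p\<in>polys m. p \<noteq> (\<lambda>x. 0) \<longrightarrow> (LINT x|lebesgue_on \<Omega>. w x * (p x)\<^sup>2) > 0)"

definition weighted_inner ::
  "(real ^ 'd::finite) set \<Rightarrow> (real ^ 'd \<Rightarrow> real) \<Rightarrow> (real ^ 'd \<Rightarrow> real) \<Rightarrow> (real ^ 'd \<Rightarrow> real) \<Rightarrow> real" where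
  "weighted_inner \<Omega> w a b = (LINT x|lebesgue_on \<Omega>. w x * a x * b x)"

definition orthonormal_basis_polys ::
  "(real ^ 'd::finite) set \<Rightarrow> (real ^ 'd \<Rightarrow> real) \<Rightarrow> nat \<Rightarrow> nat \<Rightarrow> (nat \<Rightarrow> real ^ 'd \<Rightarrow> real) \<Rightarrow> bool" where
  "orthonormal_basis_polys \<Omega> w q n e \<longleftrightarrow>
     (\<forall>a<n. e a \<in> polys (int q)) \<and>
     (\<forall>a<n. \<forall>b<n. weighted_inner \<Omega> w (e a) (e b) = (if a = b then 1 else 0)) \<and>
     (\<forall>p\<in>polys (int q). \<exists>c. p = (\<lambda>x. \<Sum>a<n. c a * e a x))"

(* The orthogonal projection onto polys q; for a suitable weight and a polynomial p
   the description is satisfied by exactly one g. *)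

definition proj_polys ::
  "(real ^ 'd::finite) set \<Rightarrow> (real ^ 'd \<Rightarrow> real) \<Rightarrow> nat \<Rightarrow> (real ^ 'd \<Rightarrow> real) \<Rightarrow> (real ^ 'd \<Rightarrow> real)" where
  "proj_polys \<Omega> w q p =
     (THE g. g \<in> polys (int q) \<and>
             (\<forall>h\<in>polys (int q). weighted_inner \<Omega> w (\<lambda>x. p x - g x) h = 0))"

definition mult_coord :: "'d \<Rightarrow> (real ^ 'd::finite \<Rightarrow> real) \<Rightarrow> (real ^ 'd \<Rightarrow> real)" where
  "mult_coord i p = (\<lambda>x. x $ i * p x)"

definition chi_op ::
  "(real ^ 'd::finite) set \<Rightarrow> (real ^ 'd \<Rightarrow> real) \<Rightarrow> nat \<Rightarrow> 'd \<Rightarrow> (real ^ 'd \<Rightarrow> real) \<Rightarrow> (real ^ 'd \<Rightarrow> real)" where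
  "chi_op \<Omega> w q i p = proj_polys \<Omega> w q (mult_coord i p)"

definition cubature_exact ::
  "(real ^ 'd::finite) set \<Rightarrow> (real ^ 'd \<Rightarrow> real) \<Rightarrow> nat \<Rightarrow> (nat \<Rightarrow> real ^ 'd) \<Rightarrow> (nat \<Rightarrow> real)
     \<Rightarrow> (real ^ 'd \<Rightarrow> real) \<Rightarrow> bool" where
  "cubature_exact \<Omega> w N node wt f \<longleftrightarrow>
     (LINT x|lebesgue_on \<Omega>. w x * f x) = (\<Sum>\<alpha><N. wt \<alpha> * f (node \<alpha>))"

definition cubature_of_degree ::
  "(real ^ 'd::finite) set \<Rightarrow> (real ^ 'd \<Rightarrow> real) \<Rightarrow> nat \<Rightarrow> nat \<Rightarrow> (nat \<Rightarrow> real ^ 'd) \<Rightarrow> (nat \<Rightarrow> real) \<Rightarrow> bool" where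
  "cubature_of_degree \<Omega> w D N node wt \<longleftrightarrow>
     (\<forall>f\<in>polys (int D). cubature_exact \<Omega> w N node wt f) \<and>
     (\<exists>f\<in>polys (int D + 1) - polys (int D). \<not> cubature_exact \<Omega> w N node wt f)"

(* The library's orthogonal_mat only asks for pairwise orthogonal nonzero columns,
   without normalisation. *)

definition is_orthogonal_mat :: "nat \<Rightarrow> real mat \<Rightarrow> bool" where
  "is_orthogonal_mat N A \<longleftrightarrow>
     A \<in> carrier_mat N N \<and> A * transpose_mat A = 1\<^sub>m N \<and> transpose_mat A * A = 1\<^sub>m N"

definition linear_on_polys :: "nat \<Rightarrow> nat \<Rightarrow> ((real ^ 'd::finite \<Rightarrow> real) \<Rightarrow> real Matrix.vec) \<Rightarrow> bool" where
  "linear_on_polys q N \<iota> \<longleftrightarrow>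
     (\<forall>p\<in>polys (int q). \<iota> p \<in> carrier_vec N) \<and>
     (\<forall>p\<in>polys (int q). \<forall>r\<in>polys (int q). \<iota> (\<lambda>x. p x + r x) = \<iota> p + \<iota> r) \<and>
     (\<forall>c. \<forall>p\<in>polys (int q). \<iota> (\<lambda>x. c * p x) = c \<cdot>\<^sub>v \<iota> p)"

end

theory Submission
  imports Defs
begin

(* The columns of Qt restricted to the first n rows evaluate the basis at the nodes, so the
   transpose of Qt maps \<iota> p to the vector of values p(x_\<alpha>) scaled by sqrt w_\<alpha>. On such
   value vectors multiplication by x_i is the diagonal matrix \<Lambda> i, and Qt maps the result back
   to \<iota> (x_i p) as soon as x_i p has degree at most q. *)

text \<open>Each single exponent is at most the total degree, so the exponents lie in a finite box.
  Finiteness matters because a sum over an infinite index set is 0 by convention.\<close>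

lemma finite_exponents: "finite {k :: 'd::finite \<Rightarrow> nat. int (\<Sum>i\<in>UNIV. k i) \<le> m}"
proof (rule finite_subset)
  show "{k :: 'd \<Rightarrow> nat. int (\<Sum>i\<in>UNIV. k i) \<le> m} \<subseteq> PiE UNIV (\<lambda>_. {..nat m})"
  proof
    fix k :: "'d \<Rightarrow> nat"
    assume "k \<in> {k. int (\<Sum>i\<in>UNIV. k i) \<le> m}"
    moreover have "k j \<le> (\<Sum>i\<in>UNIV. k i)" for j
      by (rule member_le_sum) auto
    ultimately have "k j \<le> nat m" for j
      by (metis (mono_tags) mem_Collect_eq nat_int nat_mono order_trans)
    then show "k \<in> PiE UNIV (\<lambda>_. {..nat m})"
      by auto
  qed
qed (auto intro: finite_PiE)

lemma polys_diff:
  assumes "f \<in> polys m" "g \<in> polys m"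
  shows "(\<lambda>x. f x - g x) \<in> polys m"
proof -
  from assms obtain c d
    where "f = (\<lambda>x. \<Sum>k | int (\<Sum>i\<in>UNIV. k i) \<le> m. c k * monomial_fun k x)"
      and "g = (\<lambda>x. \<Sum>k | int (\<Sum>i\<in>UNIV. k i) \<le> m. d k * monomial_fun k x)"
    by (auto simp: polys_def)
  then have "(\<lambda>x. f x - g x) =
      (\<lambda>x. \<Sum>k | int (\<Sum>i\<in>UNIV. k i) \<le> m. (c k - d k) * monomial_fun k x)"
    by (simp add: sum_subtractf left_diff_distrib)
  then show ?thesis
    unfolding polys_def by (intro CollectI exI[of _ "\<lambda>k. c k - d k"])
qed

lemma polys_add:
  assumes "f \<in> polys m" "g \<in> polys m"
  shows "(\<lambda>x. f x + g x) \<in> polys m"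
proof -
  from assms obtain c d
    where "f = (\<lambda>x. \<Sum>k | int (\<Sum>i\<in>UNIV. k i) \<le> m. c k * monomial_fun k x)"
      and "g = (\<lambda>x. \<Sum>k | int (\<Sum>i\<in>UNIV. k i) \<le> m. d k * monomial_fun k x)"
    by (auto simp: polys_def)
  then have "(\<lambda>x. f x + g x) =
      (\<lambda>x. \<Sum>k | int (\<Sum>i\<in>UNIV. k i) \<le> m. (c k + d k) * monomial_fun k x)"
    by (simp add: sum.distrib distrib_right)
  then show ?thesis
    unfolding polys_def by (intro CollectI exI[of _ "\<lambda>k. c k + d k"])
qed

lemma polys_scale:
  assumes "f \<in> polys m"
  shows "(\<lambda>x. a * f x) \<in> polys m"
proof -
  from assms obtain c
    where "f = (\<lambda>x. \<Sum>k | int (\<Sum>i\<in>UNIV. k i) \<le> m. c k * monomial_fun k x)"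
    by (auto simp: polys_def)
  then have "(\<lambda>x. a * f x) =
      (\<lambda>x. \<Sum>k | int (\<Sum>i\<in>UNIV. k i) \<le> m. (a * c k) * monomial_fun k x)"
    by (simp add: sum_distrib_left mult.assoc)
  then show ?thesis
    unfolding polys_def by (intro CollectI exI[of _ "\<lambda>k. a * c k"])
qed

lemma polys_zero: "(\<lambda>x. 0) \<in> polys m"
  unfolding polys_def by (intro CollectI exI[of _ "\<lambda>k. 0"]) simp

lemma polys_sum:
  assumes "finite A" "\<And>a. a \<in> A \<Longrightarrow> f a \<in> polys m"
  shows "(\<lambda>x. \<Sum>a\<in>A. f a x) \<in> polys m"
  using assms by (induction A rule: finite_induct) (auto intro: polys_zero polys_add)

lemma monomial_fun_in_polys:
  assumes "int (\<Sum>i\<in>UNIV. k i) \<le> m"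
  shows "monomial_fun k \<in> polys m"
proof -
  have "monomial_fun k =
      (\<lambda>x. \<Sum>l | int (\<Sum>i\<in>UNIV. l i) \<le> m. (if l = k then 1 else 0) * monomial_fun l x)"
    \<comment> \<open>\<open>of_nat_sum\<close> would push \<open>int\<close> inside the degree sum,
      and the index set would no longer match \<open>finite_exponents\<close>.\<close>
    using assms by (simp add: if_distrib[of "\<lambda>c. c * _"] sum.delta finite_exponents
        del: of_nat_sum cong: if_cong)
  then show ?thesis
    unfolding polys_def by (intro CollectI exI[of _ "\<lambda>l. if l = k then 1 else 0"])
qed

lemma mult_coord_monomial_fun:
  "mult_coord i (monomial_fun k) = monomial_fun (k(i := Suc (k i)))"
proof
  fix x :: "real ^ 'a"
  show "mult_coord i (monomial_fun k) x = monomial_fun (k(i := Suc (k i))) x"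
    unfolding mult_coord_def monomial_fun_def
    \<comment> \<open>The two products differ only in the factor at \<open>i\<close>, which is split
      off on both sides.\<close>
    by (subst (1 2) prod.remove[of UNIV i]) (auto intro!: prod.cong)
qed

text \<open>Multiplying by a coordinate turns each monomial into a monomial of degree one higher.
  The bound is an integer so that \<open>m = 0\<close> is covered: then the index set is empty and
  both functions are zero.\<close>

lemma mult_coord_in_polys:
  assumes "p \<in> polys (m - 1)"
  shows "mult_coord i p \<in> polys m"
proof -
  let ?K = "{k. int (\<Sum>i\<in>UNIV. k i) \<le> m - 1}"
  from assms obtain c where p: "p = (\<lambda>x. \<Sum>k\<in>?K. c k * monomial_fun k x)"
    by (auto simp: polys_def)
  have "mult_coord i p = (\<lambda>x. \<Sum>k\<in>?K. c k * mult_coord i (monomial_fun k) x)"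
    by (simp add: p mult_coord_def sum_distrib_left algebra_simps)
  moreover have "mult_coord i (monomial_fun k) \<in> polys m" if "k \<in> ?K" for k
  proof -
    have "(\<Sum>j\<in>UNIV. (k(i := Suc (k i))) j) = Suc (\<Sum>j\<in>UNIV. k j)"
      by (subst (1 2) sum.remove[of UNIV i]) auto
    with that show ?thesis
      by (auto simp: mult_coord_monomial_fun intro!: monomial_fun_in_polys)
  qed
  ultimately show ?thesis
    using finite_exponents[of "m - 1"]
    by (auto intro!: polys_sum polys_scale simp del: of_nat_sum)
qed

lemma polys_mono: "m \<le> m' \<Longrightarrow> polys m \<subseteq> polys m'"
proof
  fix p assume "m \<le> m'" "p \<in> polys m"
  then obtain c
    where "p = (\<lambda>x. \<Sum>k | int (\<Sum>i\<in>UNIV. k i) \<le> m. c k * monomial_fun k x)"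
    by (auto simp: polys_def)
  with \<open>m \<le> m'\<close> show "p \<in> polys m'"
    by (auto intro!: polys_sum polys_scale monomial_fun_in_polys finite_exponents simp del: of_nat_sum)
qed

text \<open>The point is uniqueness, which the description operator requires. The difference of
  \<open>p\<close> and a competitor \<open>g\<close> lies in the space itself, so it may be used as
  its own test function; its weighted square integral is then 0, and the positivity in
  \<open>suitable_weight\<close> forces it to vanish.\<close>

lemma proj_polys_id:
  assumes "suitable_weight \<Omega> w" "p \<in> polys (int q)"
  shows "proj_polys \<Omega> w q p = p"
  unfolding proj_polys_def
proof (rule the_equality)
  show "p \<in> polys (int q) \<and>
      (\<forall>h\<in>polys (int q). weighted_inner \<Omega> w (\<lambda>x. p x - p x) h = 0)"
    using assms by (simp add: weighted_inner_def)
next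
  fix g
  assume g: "g \<in> polys (int q) \<and>
      (\<forall>h\<in>polys (int q). weighted_inner \<Omega> w (\<lambda>x. p x - g x) h = 0)"
  let ?r = "\<lambda>x. p x - g x"
  have r: "?r \<in> polys (int q)"
    using assms g by (auto intro: polys_diff)
  with g have "weighted_inner \<Omega> w ?r ?r = 0"
    by blast
  then have "(LINT x|lebesgue_on \<Omega>. w x * (?r x)\<^sup>2) = 0"
    by (simp add: weighted_inner_def power2_eq_square mult.assoc)
  moreover have "?r \<noteq> (\<lambda>x. 0) \<longrightarrow> (LINT x|lebesgue_on \<Omega>. w x * (?r x)\<^sup>2) > 0"
    using assms(1) r unfolding suitable_weight_def by blast
  ultimately have "?r = (\<lambda>x. 0)"
    by auto
  then show "g = p"
    by (metis eq_iff_diff_eq_0 ext)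
qed

text \<open>Linearity is given only for two summands and for scalars, so induction on
  \<open>m\<close> extends it to sums. The step fills coordinate \<open>m\<close>, which was still
  0, with \<open>c m\<close>; the bound \<open>m \<le> N\<close> keeps this coordinate inside the
  vector.\<close>

lemma linear_on_polys_sum:
  assumes lin: "linear_on_polys q N \<iota>"
    and e: "\<And>a. a < m \<Longrightarrow> e a \<in> polys (int q)"
    and unit: "\<And>a. a < m \<Longrightarrow> \<iota> (e a) = unit_vec N a"
    and "m \<le> N"
  shows "\<iota> (\<lambda>x. \<Sum>a<m. c a * e a x) = Matrix.vec N (\<lambda>a. if a < m then c a else 0)"
  using e unit \<open>m \<le> N\<close>
proof (induction m)
  case 0
  have scale: "\<iota> (\<lambda>x. c * p x) = c \<cdot>\<^sub>v \<iota> p" and carrier: "\<iota> p \<in> carrier_vec N"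
    if "p \<in> polys (int q)" for c p
    using lin that unfolding linear_on_polys_def by blast+
  \<comment> \<open>Homogeneity with factor 0 handles the empty sum. The carrier condition then
    supplies the dimension \<open>N\<close>, which scaling alone does not determine.\<close>
  have "\<iota> (\<lambda>x. 0) = 0 \<cdot>\<^sub>v \<iota> (\<lambda>x. 0)"
    using scale[OF polys_zero, of 0] unfolding mult_zero_left .
  also have "\<dots> = 0\<^sub>v N"
    using carrier[OF polys_zero] by (intro eq_vecI) auto
  finally show ?case
    by (auto simp: zero_vec_def)
next
  case (Suc m)
  have "(\<lambda>x. \<Sum>a<m. c a * e a x) \<in> polys (int q)" "(\<lambda>x. c m * e m x) \<in> polys (int q)"
    using Suc.prems(1) by (auto intro!: polys_sum polys_scale)
  then have "\<iota> (\<lambda>x. \<Sum>a<Suc m. c a * e a x) = \<iota> (\<lambda>x. \<Sum>a<m. c a * e a x) + c m \<cdot>\<^sub>v \<iota> (e m)"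
    using lin Suc.prems(1) by (simp add: linear_on_polys_def)
  then show ?case
    using Suc by (auto intro!: eq_vecI simp: less_Suc_eq unit_vec_def)
qed

text \<open>The entries of \<open>\<iota> p\<close> are the coefficients of \<open>p\<close> in the
  basis, padded with zeros. Hence only the first \<open>n\<close> rows of \<open>Qt\<close>
  contribute, however they are completed to a square matrix, and the product sums the basis
  expansion of \<open>p\<close> at each node.\<close>

lemma transpose_mult_embedding:
  assumes basis: "orthonormal_basis_polys \<Omega> w q n e"
    and Qt: "Qt \<in> carrier_mat N N"
    and rows: "take n (Matrix.rows Qt) =
      Matrix.rows (Matrix.mat n N (\<lambda>(a, \<alpha>). s \<alpha> * e a (node \<alpha>)))"
    and lin: "linear_on_polys q N \<iota>"
    and unit: "\<forall>a<n. \<iota> (e a) = unit_vec N a"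
    and p: "p \<in> polys (int q)"
  shows "transpose_mat Qt *\<^sub>v \<iota> p = Matrix.vec N (\<lambda>\<alpha>. s \<alpha> * p (node \<alpha>))"
proof -
  let ?Q = "Matrix.mat n N (\<lambda>(a, \<alpha>). s \<alpha> * e a (node \<alpha>))"
  \<comment> \<open>The list on the left has length \<open>min n N\<close>, the one on the right has
    length \<open>n\<close>.\<close>
  have "n \<le> N"
    using arg_cong[OF rows, of length] Qt by simp
  from basis p obtain c where c: "p = (\<lambda>x. \<Sum>a<n. c a * e a x)"
    unfolding orthonormal_basis_polys_def by blast
  have \<iota>p: "\<iota> p = Matrix.vec N (\<lambda>a. if a < n then c a else 0)"
    unfolding c using basis unit \<open>n \<le> N\<close>
    by (intro linear_on_polys_sum[OF lin]) (auto simp: orthonormal_basis_polys_def)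
  have entry: "Qt $$ (a, \<alpha>) = s \<alpha> * e a (node \<alpha>)" if "a < n" "\<alpha> < N" for a \<alpha>
  proof -
    have "Matrix.row Qt a = Matrix.row ?Q a"
      using arg_cong[OF rows, of "\<lambda>l. l ! a"] that \<open>n \<le> N\<close> Qt by simp
    then have "vec_index (Matrix.row Qt a) \<alpha> = vec_index (Matrix.row ?Q a) \<alpha>"
      by simp
    then show ?thesis
      using that \<open>n \<le> N\<close> Qt by simp
  qed
  show ?thesis
  proof (rule eq_vecI)
    fix \<alpha> assume "\<alpha> < dim_vec (Matrix.vec N (\<lambda>\<alpha>. s \<alpha> * p (node \<alpha>)))"
    then have \<alpha>: "\<alpha> < N" by simp
    have "vec_index (transpose_mat Qt *\<^sub>v \<iota> p) \<alpha> =
        (\<Sum>a\<in>{0..<N}. Qt $$ (a, \<alpha>) * (if a < n then c a else 0))"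
      using \<alpha> Qt by (simp add: \<iota>p scalar_prod_def)
    also have "\<dots> = (\<Sum>a<n. Qt $$ (a, \<alpha>) * c a)"
      using \<open>n \<le> N\<close> by (intro sum.mono_neutral_cong_right) auto
    also have "\<dots> = s \<alpha> * p (node \<alpha>)"
      using \<alpha> by (simp add: c entry sum_distrib_left algebra_simps)
    finally show "vec_index (transpose_mat Qt *\<^sub>v \<iota> p) \<alpha> =
        vec_index (Matrix.vec N (\<lambda>\<alpha>. s \<alpha> * p (node \<alpha>))) \<alpha>"
      using \<alpha> by simp
  qed (use Qt in simp)
qed

theorem theorem10:
  fixes \<Omega> :: "(real ^ 'd::finite) set"
    and w :: "real ^ 'd \<Rightarrow> real"
    and q n N :: nat
    and e :: "nat \<Rightarrow> real ^ 'd \<Rightarrow> real"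
    and node :: "nat \<Rightarrow> real ^ 'd"
    and wt :: "nat \<Rightarrow> real"
    and Q Qt :: "real mat"
    and \<Lambda> At :: "'d \<Rightarrow> real mat"
    and \<iota> :: "(real ^ 'd \<Rightarrow> real) \<Rightarrow> real Matrix.vec"
  assumes "suitable_weight \<Omega> w"
    and "n = (CARD('d) + q) choose CARD('d)"
    and "orthonormal_basis_polys \<Omega> w q n e"
    and "cubature_of_degree \<Omega> w (2 * q + 1) N node wt"
    and "\<forall>\<alpha><N. 0 < wt \<alpha>"
    and "Q = Matrix.mat n N (\<lambda>(a, \<alpha>). sqrt (wt \<alpha>) * e a (node \<alpha>))"
    and "\<forall>i. \<Lambda> i = mat_diag N (\<lambda>\<alpha>. node \<alpha> $ i)"
    and "is_orthogonal_mat N Qt"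
    and "take n (Matrix.rows Qt) = Matrix.rows Q"
    and "\<forall>i. At i = Qt * \<Lambda> i * transpose_mat Qt"
    and "linear_on_polys q N \<iota>"
    and "\<forall>a<n. \<iota> (e a) = unit_vec N a"
  shows "\<forall>i. \<forall>p\<in>polys (int q - 1).
           At i *\<^sub>v \<iota> p = \<iota> (mult_coord i p) \<and>
           \<iota> (mult_coord i p) = \<iota> (chi_op \<Omega> w q i p)"
proof (intro allI ballI)
  fix i :: 'd and p :: "real ^ 'd \<Rightarrow> real"
  assume p: "p \<in> polys (int q - 1)"
  then have pq: "p \<in> polys (int q)"
    using polys_mono[of "int q - 1" "int q"] by auto
  \<comment> \<open>The degree bound \<open>q - 1\<close> is decisive here: the product still lies
    in the domain of the embedding, and the projection onto degree \<open>q\<close> fixes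
    it.\<close>
  have xp: "mult_coord i p \<in> polys (int q)"
    using p by (rule mult_coord_in_polys)
  have Qt: "Qt \<in> carrier_mat N N" and QtQtT: "Qt * transpose_mat Qt = 1\<^sub>m N"
    using assms(8) by (auto simp: is_orthogonal_mat_def)
  \<comment> \<open>The row condition fixes the scaling \<open>s \<alpha>\<close> as
    \<open>sqrt (wt \<alpha>)\<close>.\<close>
  note embed = transpose_mult_embedding[OF assms(3) Qt assms(9)[unfolded assms(6)] assms(11,12)]
  have carrier: "\<iota> p \<in> carrier_vec N" "\<iota> (mult_coord i p) \<in> carrier_vec N"
    using assms(11) pq xp by (auto simp: linear_on_polys_def)
  have \<Lambda>: "\<Lambda> i \<in> carrier_mat N N"
    using assms(7) by (simp add: mat_diag_def)
  \<comment> \<open>With \<open>embed\<close> applied to both \<open>p\<close> and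
    \<open>mult_coord i p\<close>, each side has the entry
    \<open>sqrt (wt \<alpha>) * (node \<alpha> $ i) * p (node \<alpha>)\<close> at \<alpha>, up to
    the order of the factors.\<close>
  have node_values: "\<Lambda> i *\<^sub>v (transpose_mat Qt *\<^sub>v \<iota> p) = transpose_mat Qt *\<^sub>v \<iota> (mult_coord i p)"
    unfolding embed[OF pq] embed[OF xp] assms(7)[rule_format]
    by (rule eq_vecI)
      (auto simp: mat_diag_def scalar_prod_def mult_coord_def if_distrib[of "\<lambda>c. c * _"]
        cong: if_cong)
  have "At i *\<^sub>v \<iota> p = Qt *\<^sub>v (\<Lambda> i *\<^sub>v (transpose_mat Qt *\<^sub>v \<iota> p))"
    using Qt \<Lambda> carrier assms(10)
    by (simp add: assoc_mult_mat_vec[of _ N N _ N])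
  also have "\<dots> = (Qt * transpose_mat Qt) *\<^sub>v \<iota> (mult_coord i p)"
    unfolding node_values using Qt carrier by (simp add: assoc_mult_mat_vec[of _ N N _ N])
  also have "\<dots> = \<iota> (mult_coord i p)"
    using carrier by (simp add: QtQtT)
  finally show "At i *\<^sub>v \<iota> p = \<iota> (mult_coord i p) \<and>
      \<iota> (mult_coord i p) = \<iota> (chi_op \<Omega> w q i p)"
    by (simp add: chi_op_def proj_polys_id[OF assms(1) xp])
qed

end
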